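(* The function $h(t)=e^{1/t}$ is completely monotonic on $(0,\infty)$.
   Context: A function $q(x)$ is said to be completely monotonic on an interval $I$ if $q(x)$ has derivatives of all orders on $I$ and $(-1)^{n}q^{(n)}(x)\ge 0$ for all $x\in I$ and all integers $n\ge 0$. *)

theory Defs
  imports "HOL-Analysis.Analysis"
begin

(* Derivatives are taken relative to I, hence one-sided at an end point that belongs to I;
   at interior points they are the usual two-sided ones. *)
primrec nth_deriv_on :: "real set \<Rightarrow> nat \<Rightarrow> (real \<Rightarrow> real) \<Rightarrow> real \<Rightarrow> real" where
  "nth_deriv_on I 0 q = q"
| "nth_deriv_on I (Suc n) q = (\<lambda>x. vector_derivative (nth_deriv_on I n q) (at x within I))"

(* The interval must be non-degenerate: on a single point, derivatives within I are not unique.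
   The differentiability clause guarantees that the values of nth_deriv_on are true derivatives. *)
definition completely_monotonic_on :: "real set \<Rightarrow> (real \<Rightarrow> real) \<Rightarrow> bool" where
  "completely_monotonic_on I q \<longleftrightarrow>
     is_interval I \<and> interior I \<noteq> {} \<and>
     (\<forall>n. \<forall>x\<in>I. nth_deriv_on I n q differentiable (at x within I)) \<and>
     (\<forall>n. \<forall>x\<in>I. (- 1) ^ n * nth_deriv_on I n q x \<ge> 0)"

end

theory Submission
  imports Defs "HOL-Computational_Algebra.Polynomial"
begin

text \<open>
  With \<open>s = 1 / t\<close> one has \<open>d/dt = - s\<^sup>2 d/ds\<close>, and hence for every polynomial \<open>p\<close>
  \<open>d/dt (p(s) exp s) = - s\<^sup>2 (p(s) + p'(s)) exp s\<close>.
  So the \<open>n\<close>-th derivative of \<open>exp (1 / t)\<close> is \<open>(-1)^n P\<^sub>n(1 / t) exp (1 / t)\<close>, where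
  \<open>P\<^sub>0 = 1\<close> and \<open>P\<^sub>n\<^sub>+\<^sub>1(s) = s\<^sup>2 (P\<^sub>n(s) + P\<^sub>n'(s))\<close>. This recursion preserves nonnegativity of
  coefficients, so \<open>P\<^sub>n(1 / t) \<ge> 0\<close> for \<open>t > 0\<close>.
\<close>

text \<open>The polynomials \<open>P\<^sub>n\<close>; multiplication by \<open>s\<^sup>2\<close> is a shift of the coefficients by two places.\<close>

primrec exp_inverse_poly :: "nat \<Rightarrow> real poly" where
  "exp_inverse_poly 0 = 1"
| "exp_inverse_poly (Suc n) =
     pCons 0 (pCons 0 (exp_inverse_poly n + pderiv (exp_inverse_poly n)))"

lemma coeff_exp_inverse_poly_nonneg: "coeff (exp_inverse_poly n) i \<ge> 0"
proof (induction n arbitrary: i)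
  case 0
  show ?case by (simp add: coeff_1)
next
  case (Suc n)
  then show ?case
    by (auto simp: coeff_pCons coeff_pderiv split: nat.split intro!: add_nonneg_nonneg mult_nonneg_nonneg)
qed

lemma poly_exp_inverse_poly_nonneg:
  assumes "x \<ge> 0"
  shows "poly (exp_inverse_poly n) x \<ge> 0"
  using assms by (auto simp: poly_altdef coeff_exp_inverse_poly_nonneg intro!: sum_nonneg)

lemma has_vector_derivative_poly_exp_inverse:
  fixes p :: "real poly" and x c :: real
  assumes "x > 0"
  shows "((\<lambda>t. c * (poly p (1 / t) * exp (1 / t))) has_vector_derivative
           - c * (poly (pCons 0 (pCons 0 (p + pderiv p))) (1 / x) * exp (1 / x))) (at x within S)"
proof -
  have inv: "((\<lambda>t. 1 / t) has_real_derivative - (1 / x * (1 / x))) (at x within S)"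
    using assms by (auto intro!: derivative_eq_intros simp: field_simps)
  have "((\<lambda>t. c * (poly p (1 / t) * exp (1 / t))) has_real_derivative
          c * (poly (pderiv p) (1 / x) * (- (1 / x * (1 / x))) * exp (1 / x)
             + exp (1 / x) * (- (1 / x * (1 / x))) * poly p (1 / x))) (at x within S)"
    by (intro DERIV_cmult DERIV_mult DERIV_chain2[OF poly_DERIV inv] DERIV_chain2[OF DERIV_exp inv])
  then show ?thesis
    by (simp add: has_real_derivative_iff_has_vector_derivative algebra_simps)
qed

lemma nth_deriv_on_exp_inverse:
  assumes "x > 0"
  shows "nth_deriv_on {0<..} n (\<lambda>t. exp (1 / t)) x =
           (- 1) ^ n * (poly (exp_inverse_poly n) (1 / x) * exp (1 / x))"
    and "(nth_deriv_on {0<..} n (\<lambda>t. exp (1 / t)) has_vector_derivative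
           (- 1) ^ Suc n * (poly (exp_inverse_poly (Suc n)) (1 / x) * exp (1 / x)))
           (at x within {0<..})"
  using assms
proof (induction n arbitrary: x)
  case 0
  {
    case 1
    show ?case by simp
  next
    case 2
    then show ?case
      using has_vector_derivative_poly_exp_inverse[of x 1 1 "{0<..}"] by simp
  }
next
  case (Suc n)
  have formula: "nth_deriv_on {0<..} (Suc n) (\<lambda>t. exp (1 / t)) y =
      (- 1) ^ Suc n * (poly (exp_inverse_poly (Suc n)) (1 / y) * exp (1 / y))" if "y > 0" for y
    \<comment> \<open>Derivatives within \<open>{0<..}\<close> are unique because this set is open.\<close>
    using Suc.IH(2)[OF that] that
    by (simp add: at_within_open[of y "{0<..}"] vector_derivative_at del: exp_inverse_poly.simps)
  {
    case 1
    then show ?case by (rule formula)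
  next
    case 2
    have "((\<lambda>t. (- 1) ^ Suc n * (poly (exp_inverse_poly (Suc n)) (1 / t) * exp (1 / t)))
        has_vector_derivative
        (- 1) ^ Suc (Suc n) * (poly (exp_inverse_poly (Suc (Suc n))) (1 / x) * exp (1 / x)))
        (at x within {0<..})"
      using has_vector_derivative_poly_exp_inverse[OF 2, of "(- 1) ^ Suc n"
          "exp_inverse_poly (Suc n)" "{0<..}"]
      unfolding exp_inverse_poly.simps(2)[of "Suc n"] by simp
    from has_vector_derivative_transform[OF _ _ this] show ?case
      using 2 formula by (simp only: greaterThan_iff)
  }
qed

theorem theorem6:
  shows "completely_monotonic_on {0<..} (\<lambda>t::real. exp (1 / t))"
  unfolding completely_monotonic_on_def
proof (intro conjI allI ballI)
  show "is_interval {0::real<..}"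
    by (rule is_interval_oi)
  show "interior {0::real<..} \<noteq> {}"
    by (simp add: interior_open)
next
  fix n and x :: real
  assume "x \<in> {0<..}"
  then have "x > 0" by simp
  show "nth_deriv_on {0<..} n (\<lambda>t. exp (1 / t)) differentiable (at x within {0<..})"
    using nth_deriv_on_exp_inverse(2)[OF \<open>x > 0\<close>] by (rule differentiableI_vector)
  have "(- 1) ^ n * nth_deriv_on {0<..} n (\<lambda>t. exp (1 / t)) x =
      poly (exp_inverse_poly n) (1 / x) * exp (1 / x)"
    by (simp add: nth_deriv_on_exp_inverse(1)[OF \<open>x > 0\<close>] flip: mult.assoc power_mult_distrib)
  also have "\<dots> \<ge> 0"
    using \<open>x > 0\<close> by (simp add: poly_exp_inverse_poly_nonneg)
  finally show "(- 1) ^ n * nth_deriv_on {0<..} n (\<lambda>t. exp (1 / t)) x \<ge> 0" .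
qed

end
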